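(* Assume that $X$ is closed and convex, that there is a continuous selection $\nabla_\Phi f$ of $\partial_\Phi f$ on $\operatorname{int}X$, and that $\operatorname{rge}(\partial_\Phi g)^{-1}\subseteq\operatorname{int}X$. Let $x^0\in\operatorname{int}X$ and let $\{x^k\}_{k\in\mathbb{N}_0}$ be generated by the $\Phi$-Bregman proximal point iteration $$x^{k+1}\in\operatorname{argmin}_{x\in X}\;F(x)+D_f^\Phi(x,x^k).$$ Let moreover $F=g-f$ be convex and let $f$ and $\Phi(\cdot,y)$ (for $y\in Y$) be differentiable on $\operatorname{int}X$. If the three-point property $$\langle\nabla f(x^{k+1})-\nabla_x\Phi(x^{k+1},\nabla_\Phi f(x^k)),\,x-x^{k+1}\rangle\le D_f^\Phi(x,x^k)-D_f^\Phi(x,x^{k+1})-D_f^\Phi(x^{k+1},x^k)$$ holds for all $x\in X$ and all $k\in\mathbb{N}_0$, then for all $K\ge1$ and all $x\in X$ $$F(x^K)-F(x)\le\frac{D_f^\Phi(x,x^0)}{K}.$$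
   Context: Setting. $X\subseteq\mathbb{R}^n$ and $Y\subseteq\mathbb{R}^m$ are nonempty and $\Phi:X\times Y\to\mathbb{R}$ is jointly continuous relative to $X\times Y$. $\overline{\mathbb{R}}=\mathbb{R}\cup\{\pm\infty\}$. A function is proper if it never takes the value $-\infty$ and is not identically $+\infty$. A function $f:X\to\overline{\mathbb{R}}$ is $\Phi$-convex if there are an index set $I$ and $(y_i,\beta_i)\in Y\times\overline{\mathbb{R}}$, $i\in I$, with $f(x)=\sup_{i\in I}\Phi(x,y_i)-\beta_i$ for all $x\in X$ (and $f\equiv-\infty$ if $I=\emptyset$). Standing assumptions: $f:X\to\overline{\mathbb{R}}$ is proper and $\Phi$-convex; $g:X\to\overline{\mathbb{R}}$ is proper and lower semicontinuous relative to $X$, and there exist $y\in Y$, $\beta\in\mathbb{R}$ with $g\ge\Phi(\cdot,y)-\beta$ on $X$; $F:=g-f$ (with the convention $g(x)-f(x)=+\infty$ if both values are $+\infty$) satisfies $-\infty<\inf_X F<\infty$. $\Phi$-subdifferential: for $\varphi:X\to\overline{\mathbb{R}}$, $y\in\partial_\Phi\varphi(\bar x)$ iff $y\in Y$ and $\varphi(x)\ge\varphi(\bar x)+\Phi(x,y)-\Phi(\bar x,y)$ for all $x\in X$. Inverse: $(\partial_\Phi g)^{-1}(y)=\{x\in X:y\in\partial_\Phi g(x)\}=\operatorname{argmin}_{x\in X}\{g(x)-\Phi(x,y)\}$. Well-definedness assumption: $\emptyset\ne\operatorname{rge}(\partial_\Phi g)^{-1}\subseteq\operatorname{dom}\partial_\Phi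 f$ and $\emptyset\neq\operatorname{rge}\partial_\Phi f\subseteq\operatorname{dom}(\partial_\Phi g)^{-1}$ (dom = set of points with nonempty image, rge = union of all images). A continuous selection $\nabla_\Phi f$ of $\partial_\Phi f$ on $\operatorname{int}X$ is a continuous map $\nabla_\Phi f:\operatorname{int}X\to Y$ with $\nabla_\Phi f(x)\in\partial_\Phi f(x)$ for all $x\in\operatorname{int}X$. $\Phi$-Bregman divergence: $D_f^\Phi(x,\bar x)=f(x)-f(\bar x)-\Phi(x,\nabla_\Phi f(\bar x))+\Phi(\bar x,\nabla_\Phi f(\bar x))$ for $x\in X$, $\bar x\in\operatorname{int}X$. The iteration in the claim is equivalent to $y^k=\nabla_\Phi f(x^k)$, $x^{k+1}\in(\partial_\Phi g)^{-1}(y^k)$. *)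

theory Defs
  imports "HOL-Analysis.Analysis"
begin

text \<open>
  Functions \<open>X \<rightarrow> [-\<infinity>, \<infinity>]\<close> are total functions into \<^typ>\<open>ereal\<close> of which only the values on
  \<open>X\<close> are used; likewise \<open>\<Phi>\<close> is only used on \<open>X \<times> Y\<close>. Subtraction on
  \<^typ>\<open>ereal\<close> satisfies \<open>\<infinity> - \<infinity> = \<infinity>\<close>, which is exactly the convention
  wanted for differences of extended-real-valued functions.
\<close>

definition proper_on :: "'a set \<Rightarrow> ('a \<Rightarrow> ereal) \<Rightarrow> bool" where
  "proper_on X f \<longleftrightarrow> (\<forall>x\<in>X. f x \<noteq> -\<infinity>) \<and> (\<exists>x\<in>X. f x \<noteq> \<infinity>)"

text \<open>The limit inferior is over the punctured neighbourhood, hence is \<open>\<infinity>\<close> at isolated points.\<close>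

definition lsc_on :: "'a::topological_space set \<Rightarrow> ('a \<Rightarrow> ereal) \<Rightarrow> bool" where
  "lsc_on X f \<longleftrightarrow> (\<forall>x\<in>X. f x \<le> Liminf (at x within X) f)"

text \<open>
  Since \<open>\<infinity> + (-\<infinity>) = \<infinity>\<close> in \<^typ>\<open>ereal\<close>, this is equivalent to convexity of
  the epigraph also for functions attaining \<open>-\<infinity>\<close>.
\<close>

definition ereal_convex_on :: "'a::real_vector set \<Rightarrow> ('a \<Rightarrow> ereal) \<Rightarrow> bool" where
  "ereal_convex_on X f \<longleftrightarrow> convex X \<and>
     (\<forall>x\<in>X. \<forall>y\<in>X. \<forall>t\<in>{0<..<1::real}.
        f ((1 - t) *\<^sub>R x + t *\<^sub>R y) \<le> ereal (1 - t) * f x + ereal t * f y)"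

text \<open>
  The index set is the set \<open>P\<close> of pairs \<open>(y, \<beta>)\<close> itself, since a supremum over a family only
  depends on its range. For \<open>P = {}\<close> the supremum is \<open>-\<infinity>\<close>.
\<close>

definition Phi_convex_on ::
  "'a set \<Rightarrow> 'b set \<Rightarrow> ('a \<Rightarrow> 'b \<Rightarrow> real) \<Rightarrow> ('a \<Rightarrow> ereal) \<Rightarrow> bool" where
  "Phi_convex_on X Y \<Phi> f \<longleftrightarrow>
     (\<exists>P \<subseteq> Y \<times> UNIV. \<forall>x\<in>X. f x = (SUP (y, \<beta>)\<in>P. ereal (\<Phi> x y) - \<beta>))"

text \<open>
  The set-valued map \<open>\<partial>\<^sub>\<Phi>\<phi>\<close> is represented by its graph. Its inverse, domain and range are then
  \<^const>\<open>converse\<close>, \<^const>\<open>Domain\<close> and \<^const>\<open>Range\<close>.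
\<close>

definition Phi_subdiff ::
  "'a set \<Rightarrow> 'b set \<Rightarrow> ('a \<Rightarrow> 'b \<Rightarrow> real) \<Rightarrow> ('a \<Rightarrow> ereal) \<Rightarrow> ('a \<times> 'b) set" where
  "Phi_subdiff X Y \<Phi> \<phi> =
     {(xb, y). xb \<in> X \<and> y \<in> Y \<and>
        (\<forall>x\<in>X. \<phi> x \<ge> \<phi> xb + ereal (\<Phi> x y) - ereal (\<Phi> xb y))}"

definition continuous_selection ::
  "('a::topological_space \<times> 'b::topological_space) set \<Rightarrow> 'a set \<Rightarrow> ('a \<Rightarrow> 'b) \<Rightarrow> bool" where
  "continuous_selection G U s \<longleftrightarrow> continuous_on U s \<and> (\<forall>x\<in>U. (x, s x) \<in> G)"

text \<open>The argument \<open>s\<close> is the selection \<open>\<nabla>\<^sub>\<Phi>f\<close>.\<close>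

definition Phi_Bregman ::
  "('a \<Rightarrow> 'b \<Rightarrow> real) \<Rightarrow> ('a \<Rightarrow> ereal) \<Rightarrow> ('a \<Rightarrow> 'b) \<Rightarrow> 'a \<Rightarrow> 'a \<Rightarrow> ereal" where
  "Phi_Bregman \<Phi> f s x xb = f x - f xb - ereal (\<Phi> x (s xb)) + ereal (\<Phi> xb (s xb))"

definition gradient :: "('a::real_inner \<Rightarrow> real) \<Rightarrow> 'a \<Rightarrow> 'a" where
  "gradient h x = (THE D. GDERIV h x :> D)"

end

theory Submission
  imports Defs
begin

text \<open>
  The step \<open>x\<^sup>k \<mapsto> x\<^sup>k\<^sup>+\<^sup>1\<close> minimises a convex function \<open>F\<close> plus a function
  \<open>H\<^sub>k = D(\<sqdot>, x\<^sup>k)\<close> that is differentiable on the interior of \<open>X\<close>. Moving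
  from the minimiser a little towards any \<open>u\<close> gives the first-order inequality
  \<open>F(x\<^sup>k\<^sup>+\<^sup>1) - F(u) \<le> \<langle>\<nabla>H\<^sub>k(x\<^sup>k\<^sup>+\<^sup>1), u - x\<^sup>k\<^sup>+\<^sup>1\<rangle>\<close>
  (\<open>convex_plus_differentiable_min\<close>). Its right-hand side is the left-hand side of the three-point
  property, so that \<open>F(x\<^sup>k\<^sup>+\<^sup>1) - F(u) \<le> D(u, x\<^sup>k) - D(u, x\<^sup>k\<^sup>+\<^sup>1)\<close>, since divergences are
  nonnegative. Summed over \<open>k < K\<close> this telescopes, and \<open>F(x\<^sup>k)\<close> decreases for \<open>k \<ge> 1\<close>, so the last
  gap is at most the average one (\<open>telescoping_rate\<close>).

  The rest is bookkeeping with infinite values. A point with a \<open>\<Phi>\<close>-subgradient of a proper function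
  has a finite value, so \<open>f\<close> is finite on the interior of \<open>X\<close>. In the objective \<open>F + D(\<sqdot>, x\<^sup>k)\<close> the two
  copies of \<open>f\<close> cancel, even where \<open>f = \<infinity>\<close>, because \<open>F\<close> is bounded below; what remains is
  \<open>g - \<Phi>(\<sqdot>, y\<^sup>k)\<close> up to a constant, where \<open>y\<^sup>k = s x\<^sup>k\<close>. Hence \<open>y\<^sup>k\<close> is a \<open>\<Phi>\<close>-subgradient of \<open>g\<close> at \<open>x\<^sup>k\<^sup>+\<^sup>1\<close>, which
  keeps the iterates in the interior of \<open>X\<close> and makes \<open>F(x\<^sup>k)\<close> finite for \<open>k \<ge> 1\<close>. The value
  \<open>F(x\<^sup>0)\<close> may be infinite, but it never enters the sum.
\<close>

section \<open>First-order condition for a convex plus a differentiable function\<close>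

lemma has_derivative_gradient:
  fixes h :: "'a::euclidean_space \<Rightarrow> real"
  assumes "h differentiable (at z)"
  shows "(h has_derivative (\<lambda>v. inner (gradient h z) v)) (at z)"
proof -
  from assms obtain h' where h': "(h has_derivative h') (at z)"
    unfolding differentiable_def by blast
  then have "linear h'"
    by (rule has_derivative_linear)
  \<comment> \<open>The adjoint at \<open>1\<close> is the Riesz representative of \<open>h'\<close>.\<close>
  then have "h' = (\<lambda>v. inner v (adjoint h' 1))"
    by (simp add: adjoint_works)
  with h' have D: "GDERIV h z :> adjoint h' 1"
    by (simp add: gderiv_def)
  moreover have "gradient h z = adjoint h' 1"
    unfolding gradient_def
  proof (rule the_equality)
    fix D
    assume "GDERIV h z :> D"
    then have "(\<lambda>v. inner v D) = (\<lambda>v. inner v (adjoint h' 1))"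
      using D unfolding gderiv_def by (rule has_derivative_unique)
    then show "D = adjoint h' 1"
      by (metis vector_eq_ldot)
  qed (rule D)
  ultimately show ?thesis
    by (simp add: gderiv_def inner_commute)
qed

text \<open>
  Along the segment from the minimiser \<open>z\<close> to \<open>u\<close>, convexity bounds \<open>F\<close> by its chord, so the real function
  \<open>t \<mapsto> H (z + t (u - z)) - t (a - b)\<close> cannot decrease to the right of \<open>0\<close>, and its derivative
  there is nonnegative.
\<close>

lemma convex_plus_differentiable_min:
  fixes F :: "'a::real_normed_vector \<Rightarrow> ereal" and H :: "'a \<Rightarrow> real"
  assumes conv: "ereal_convex_on X F"
    and z: "z \<in> interior X" and u: "u \<in> X"
    and Fz: "F z = ereal a" and Fu: "F u = ereal b"
    and H: "(H has_derivative H') (at z)"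
    and min: "\<And>v. v \<in> interior X \<Longrightarrow> F z + ereal (H z) \<le> F v + ereal (H v)"
  shows "a - b \<le> H' (u - z)"
proof (rule ccontr)
  assume "\<not> a - b \<le> H' (u - z)"
  then have neg: "H' (u - z) - (a - b) < 0"
    by simp
  define p where "p t = z + t *\<^sub>R (u - z)" for t :: real
  have p: "(p has_derivative (\<lambda>t. t *\<^sub>R (u - z))) (at 0)"
    unfolding p_def by (auto intro!: derivative_eq_intros)
  have "(H has_derivative H') (at (p 0))"
    using H by (simp add: p_def)
  from has_derivative_compose[OF p this]
  have "((\<lambda>t. H (p t)) has_derivative (\<lambda>t. H' (t *\<^sub>R (u - z)))) (at 0)" .
  then have "((\<lambda>t. H (p t)) has_real_derivative H' (u - z)) (at 0)"
    using has_derivative_linear[OF H]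
    by (simp add: has_field_derivative_def linear_cmul mult_commute_abs)
  then have "((\<lambda>t. H (p t) - t * (a - b)) has_real_derivative H' (u - z) - (a - b)) (at 0)"
    by (auto intro!: derivative_eq_intros)
  from DERIV_neg_dec_right[OF this neg] obtain d where d: "d > 0"
    and dec: "\<And>t. 0 < t \<Longrightarrow> t < d \<Longrightarrow> H (p t) - t * (a - b) < H z"
    by (auto simp: p_def)
  have "isCont p 0"
    using p by (rule has_derivative_continuous)
  then have "\<forall>\<^sub>F t in at 0. p t \<in> interior X"
    using z open_interior by (auto simp: isCont_def p_def dest: topological_tendstoD)
  then obtain e where e: "e > 0" and int: "\<And>t. 0 < t \<Longrightarrow> t < e \<Longrightarrow> p t \<in> interior X"
    by (auto simp: eventually_at)
  define t where "t = Min {d, e, 1} / 2"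
  have t: "0 < t" "t < d" "t < e" "t < 1"
    using d e by (auto simp: t_def min_def)
  have "z \<in> X"
    using z interior_subset by blast
  have "p t = (1 - t) *\<^sub>R z + t *\<^sub>R u"
    by (simp add: p_def algebra_simps)
  then have "F (p t) \<le> ereal (1 - t) * F z + ereal t * F u"
    using conv \<open>z \<in> X\<close> u t by (auto simp: ereal_convex_on_def)
  then have chord: "F (p t) \<le> ereal ((1 - t) * a + t * b)"
    by (simp add: Fz Fu)
  have "ereal (a + H z) \<le> F (p t) + ereal (H (p t))"
    using min[OF int[OF t(1,3)]] by (simp add: Fz)
  also have "\<dots> \<le> ereal ((1 - t) * a + t * b) + ereal (H (p t))"
    using chord by (rule add_right_mono)
  finally have "H z \<le> H (p t) - t * (a - b)"
    by (simp add: algebra_simps)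
  with dec[OF t(1,2)] show False
    by simp
qed

section \<open>Rate from a telescoping sum\<close>

text \<open>
  The index of \<open>a\<close> is shifted in \<open>decr\<close>, so \<open>a 0\<close> is unconstrained: it stands for the objective at
  the starting point, which can be infinite.
\<close>

lemma telescoping_rate:
  fixes a d :: "nat \<Rightarrow> real"
  assumes step: "\<And>k. a (Suc k) - b \<le> d k - d (Suc k)"
    and decr: "\<And>k. a (Suc (Suc k)) \<le> a (Suc k)"
    and nonneg: "\<And>k. 0 \<le> d k"
    and K: "1 \<le> K"
  shows "a K - b \<le> d 0 / real K"
proof -
  have "real (Suc n) * (a (Suc n) - b) \<le> d 0 - d (Suc n)" for n
  proof (induction n)
    case 0
    show ?case using step[of 0] by simp
  next
    case (Suc n)
    have "real (Suc n) * (a (Suc (Suc n)) - b) \<le> real (Suc n) * (a (Suc n) - b)"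
      using decr by (intro mult_left_mono) auto
    with Suc.IH step[of "Suc n"] show ?case
      by (simp add: algebra_simps)
  qed
  from this[of "K - 1"] K have "real K * (a K - b) \<le> d 0"
    using nonneg[of K] by simp
  with K show ?thesis
    by (simp add: field_simps)
qed

section \<open>Subgradients, divergences and the proximal step\<close>

lemma Phi_subdiff_finite:
  assumes "proper_on X \<phi>" "(z, y) \<in> Phi_subdiff X Y \<Phi> \<phi>"
  shows "\<bar>\<phi> z\<bar> \<noteq> \<infinity>"
proof -
  obtain w where "w \<in> X" "\<phi> w \<noteq> \<infinity>"
    using assms(1) by (auto simp: proper_on_def)
  with assms have "\<phi> z + ereal (\<Phi> w y) - ereal (\<Phi> z y) \<le> \<phi> w" "\<phi> z \<noteq> -\<infinity>"
    by (auto simp: Phi_subdiff_def proper_on_def)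
  with \<open>\<phi> w \<noteq> \<infinity>\<close> show ?thesis
    by (cases "\<phi> z") auto
qed

lemma Phi_Bregman_self:
  assumes "\<bar>f z\<bar> \<noteq> \<infinity>"
  shows "Phi_Bregman \<Phi> f s z z = 0"
  using assms by (cases "f z") (auto simp: Phi_Bregman_def zero_ereal_def)

lemma Phi_Bregman_nonneg:
  assumes "proper_on X f" "(z, s z) \<in> Phi_subdiff X Y \<Phi> f" "u \<in> X"
  shows "0 \<le> Phi_Bregman \<Phi> f s u z"
proof -
  have "f z + ereal (\<Phi> u (s z)) - ereal (\<Phi> z (s z)) \<le> f u"
    using assms(2,3) by (auto simp: Phi_subdiff_def)
  with Phi_subdiff_finite[OF assms(1,2)] show ?thesis
    by (cases "f z"; cases "f u") (auto simp: Phi_Bregman_def)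
qed

text \<open>
  Where \<open>f u = \<infinity>\<close>, the difference \<open>g u - f u\<close> avoids \<open>-\<infinity>\<close> only if \<open>g u = \<infinity>\<close> too, and then both
  sides are \<open>\<infinity>\<close>; so the cancellation of \<open>f u\<close> is valid for infinite values as well.
\<close>

lemma prox_objective_eq:
  assumes "\<bar>f z\<bar> \<noteq> \<infinity>" "f u \<noteq> -\<infinity>" "g u - f u \<noteq> -\<infinity>"
  shows "(g u - f u) + Phi_Bregman \<Phi> f s u z
    = g u - ereal (\<Phi> u (s z)) + ereal (\<Phi> z (s z) - real_of_ereal (f z))"
  using assms by (cases "f z"; cases "f u"; cases "g u") (auto simp: Phi_Bregman_def)

lemma prox_arg_min_subdiff:
  assumes "proper_on X f" "\<bar>f z\<bar> \<noteq> \<infinity>" "s z \<in> Y"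
    and F: "\<And>u. u \<in> X \<Longrightarrow> g u - f u \<noteq> -\<infinity>"
    and min: "is_arg_min (\<lambda>u. (g u - f u) + Phi_Bregman \<Phi> f s u z) (\<lambda>u. u \<in> X) w"
  shows "(w, s z) \<in> Phi_subdiff X Y \<Phi> g"
proof -
  have w: "w \<in> X"
    using min by (simp add: is_arg_min_def)
  have "g w + ereal (\<Phi> u (s z)) - ereal (\<Phi> w (s z)) \<le> g u" if u: "u \<in> X" for u
  proof -
    have "(g w - f w) + Phi_Bregman \<Phi> f s w z \<le> (g u - f u) + Phi_Bregman \<Phi> f s u z"
      using min u by (auto simp: is_arg_min_def not_less)
    moreover have "f v \<noteq> -\<infinity>" if "v \<in> X" for v
      using assms(1) that by (auto simp: proper_on_def)
    ultimately have "g w - ereal (\<Phi> w (s z)) + ereal (\<Phi> z (s z) - real_of_ereal (f z))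
        \<le> g u - ereal (\<Phi> u (s z)) + ereal (\<Phi> z (s z) - real_of_ereal (f z))"
      using assms(2) F w u by (simp add: prox_objective_eq)
    then show ?thesis
      by (cases "g w"; cases "g u") auto
  qed
  with w assms(3) show ?thesis
    by (auto simp: Phi_subdiff_def)
qed

section \<open>Sublinear convergence of the proximal point iteration\<close>

theorem theorem5p8:
  fixes X :: "(real ^ 'n) set" and Y :: "(real ^ 'm) set"
    and \<Phi> :: "real ^ 'n \<Rightarrow> real ^ 'm \<Rightarrow> real"
    and f g F :: "real ^ 'n \<Rightarrow> ereal"
    and s :: "real ^ 'n \<Rightarrow> real ^ 'm"
    and x :: "nat \<Rightarrow> real ^ 'n"
  assumes "X \<noteq> {}" and "Y \<noteq> {}"
    and "continuous_on (X \<times> Y) (\<lambda>(u, y). \<Phi> u y)"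
    and "proper_on X f" and "Phi_convex_on X Y \<Phi> f"
    and "proper_on X g" and "lsc_on X g"
    and "\<exists>y\<in>Y. \<exists>\<beta>::real. \<forall>u\<in>X. g u \<ge> ereal (\<Phi> u y - \<beta>)"
    and F_def: "F = (\<lambda>u. g u - f u)"
    and "-\<infinity> < (INF u\<in>X. F u)" and "(INF u\<in>X. F u) < \<infinity>"
    and "Range ((Phi_subdiff X Y \<Phi> g)\<inverse>) \<noteq> {}"
    and "Range ((Phi_subdiff X Y \<Phi> g)\<inverse>) \<subseteq> Domain (Phi_subdiff X Y \<Phi> f)"
    and "Range (Phi_subdiff X Y \<Phi> f) \<noteq> {}"
    and "Range (Phi_subdiff X Y \<Phi> f) \<subseteq> Domain ((Phi_subdiff X Y \<Phi> g)\<inverse>)"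
    and "closed X" and "convex X"
    and "continuous_selection (Phi_subdiff X Y \<Phi> f) (interior X) s"
    and "Range ((Phi_subdiff X Y \<Phi> g)\<inverse>) \<subseteq> interior X"
    and "x 0 \<in> interior X"
    and iter: "\<And>k. is_arg_min (\<lambda>u. F u + Phi_Bregman \<Phi> f s u (x k)) (\<lambda>u. u \<in> X) (x (Suc k))"
    and "ereal_convex_on X F"
    and "(\<lambda>u. real_of_ereal (f u)) differentiable_on interior X"
    and "\<And>y. y \<in> Y \<Longrightarrow> (\<lambda>u. \<Phi> u y) differentiable_on interior X"
    and three_point: "\<And>k u. u \<in> X \<Longrightarrow>
        ereal (inner (gradient (\<lambda>v. real_of_ereal (f v)) (x (Suc k))
                      - gradient (\<lambda>v. \<Phi> v (s (x k))) (x (Suc k)))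
                     (u - x (Suc k)))
        \<le> Phi_Bregman \<Phi> f s u (x k) - Phi_Bregman \<Phi> f s u (x (Suc k))
           - Phi_Bregman \<Phi> f s (x (Suc k)) (x k)"
  shows "\<forall>K::nat. K \<ge> 1 \<longrightarrow>
      (\<forall>u\<in>X. F (x K) - F u \<le> Phi_Bregman \<Phi> f s u (x 0) / ereal (real K))"
proof -
  let ?D = "Phi_Bregman \<Phi> f s"
  have F_lower: "g u - f u \<noteq> -\<infinity>" if "u \<in> X" for u
  proof -
    have "(INF u\<in>X. F u) \<le> F u"
      using that by (rule INF_lower)
    with \<open>-\<infinity> < (INF u\<in>X. F u)\<close> show ?thesis
      by (auto simp: F_def)
  qed
  have sel: "(z, s z) \<in> Phi_subdiff X Y \<Phi> f" if "z \<in> interior X" for z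
    using assms(18) that by (auto simp: continuous_selection_def)
  have sY: "s z \<in> Y" if "z \<in> interior X" for z
    using sel[OF that] by (auto simp: Phi_subdiff_def)
  have f_fin: "\<bar>f z\<bar> \<noteq> \<infinity>" if "z \<in> interior X" for z
    using Phi_subdiff_finite[OF \<open>proper_on X f\<close> sel[OF that]] .
  have f_lower: "f u \<noteq> -\<infinity>" if "u \<in> X" for u
    using \<open>proper_on X f\<close> that by (auto simp: proper_on_def)
  have sub: "(x (Suc k), s (x k)) \<in> Phi_subdiff X Y \<Phi> g" if "x k \<in> interior X" for k
    using prox_arg_min_subdiff[where s = s, OF \<open>proper_on X f\<close> f_fin[OF that] sY[OF that] F_lower]
      iter[of k] by (simp add: F_def)
  have x_int: "x k \<in> interior X" for k
  proof (induction k)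
    case 0
    show ?case by fact
  next
    case (Suc k)
    show ?case
      using sub[OF Suc] assms(19) by blast
  qed
  have xX: "x k \<in> X" for k
    using x_int interior_subset by blast
  define a where "a k = real_of_ereal (F (x k))" for k
  have F_fin: "F (x (Suc k)) = ereal (a (Suc k))" for k
    using Phi_subdiff_finite[OF \<open>proper_on X g\<close> sub[OF x_int[of k]]] f_fin[OF x_int[of "Suc k"]]
    unfolding a_def F_def
    by (cases "g (x (Suc k))"; cases "f (x (Suc k))") auto
  have D_nonneg: "0 \<le> ?D u (x k)" if "u \<in> X" for u k
    using Phi_Bregman_nonneg[where s = s, OF \<open>proper_on X f\<close> sel[OF x_int] that] .
  have min: "F (x (Suc k)) + ?D (x (Suc k)) (x k) \<le> F u + ?D u (x k)" if "u \<in> X" for k u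
    using iter[of k] that by (auto simp: is_arg_min_def not_less)
  \<comment> \<open>Compare the next iterate with staying put, which has divergence \<open>0\<close>.\<close>
  have decr: "a (Suc (Suc k)) \<le> a (Suc k)" for k
  proof -
    have "F (x (Suc (Suc k))) + 0 \<le> F (x (Suc (Suc k))) + ?D (x (Suc (Suc k))) (x (Suc k))"
      using D_nonneg[OF xX] by (rule add_left_mono)
    also have "\<dots> \<le> F (x (Suc k)) + ?D (x (Suc k)) (x (Suc k))"
      by (rule min[OF xX])
    also have "\<dots> = F (x (Suc k))"
      by (simp add: Phi_Bregman_self f_fin[OF x_int])
    finally show ?thesis
      by (simp add: F_fin)
  qed
  show ?thesis
  proof (intro allI impI ballI)
    fix K :: nat and u
    assume K: "1 \<le> K" and u: "u \<in> X"
    then have FK: "F (x K) = ereal (a K)"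
      using F_fin[of "K - 1"] by simp
    show "F (x K) - F u \<le> ?D u (x 0) / ereal (real K)"
    proof (cases "F u = \<infinity>")
      case True
      with FK show ?thesis
        by simp
    next
      case False
      then obtain b where b: "F u = ereal b"
        using F_lower[OF u] by (cases "F u") (auto simp: F_def)
      have fu: "\<bar>f u\<bar> \<noteq> \<infinity>"
        using b f_lower[OF u] by (cases "f u"; cases "g u") (auto simp: F_def)
      have D_real: "?D v (x k) = ereal (real_of_ereal (f v) - real_of_ereal (f (x k))
            - \<Phi> v (s (x k)) + \<Phi> (x k) (s (x k)))" if "\<bar>f v\<bar> \<noteq> \<infinity>" for v k
        using that f_fin[OF x_int[of k]]
        by (cases "f v"; cases "f (x k)") (auto simp: Phi_Bregman_def)
      define d where "d k = real_of_ereal (?D u (x k))" for k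
      have d: "?D u (x k) = ereal (d k)" for k
        by (simp add: d_def D_real[OF fu])
      have d_nonneg: "0 \<le> d k" for k
        using D_nonneg[OF u, of k] by (simp add: d)
      have step: "a (Suc k) - b \<le> d k - d (Suc k)" for k
      proof -
        let ?f = "\<lambda>v. real_of_ereal (f v)" and ?\<phi> = "\<lambda>v. \<Phi> v (s (x k))"
        let ?c = "\<Phi> (x k) (s (x k)) - ?f (x k)"
        let ?z = "x (Suc k)"
        \<comment> \<open>The real-valued form of the divergence to \<open>x k\<close>; its gradient is the difference of gradients
          in the three-point property.\<close>
        define H where "H v = ?f v - ?\<phi> v + ?c" for v
        have H: "?D v (x k) = ereal (H v)" if "\<bar>f v\<bar> \<noteq> \<infinity>" for v
          using D_real[OF that] by (simp add: H_def)
        have at_z: "at ?z within interior X = at ?z"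
          by (rule at_within_open[OF x_int open_interior])
        have "?f differentiable (at ?z)"
          using assms(23) x_int[of "Suc k"] unfolding differentiable_on_def by (metis at_z)
        moreover have "?\<phi> differentiable (at ?z)"
          using assms(24)[OF sY[OF x_int[of k]]] x_int[of "Suc k"]
          unfolding differentiable_on_def by (metis at_z)
        ultimately have "(H has_derivative
            (\<lambda>v. inner (gradient ?f ?z) v - inner (gradient ?\<phi> ?z) v + 0)) (at ?z)"
          unfolding H_def
          by (intro has_derivative_add has_derivative_diff has_derivative_gradient
              has_derivative_const)
        then have "(H has_derivative (\<lambda>v. inner (gradient ?f ?z - gradient ?\<phi> ?z) v)) (at ?z)"
          by (simp add: inner_diff_left)
        moreover have "F ?z + ereal (H ?z) \<le> F v + ereal (H v)" if "v \<in> interior X" for v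
        proof -
          have "v \<in> X"
            using that interior_subset by blast
          from min[OF this, of k] show ?thesis
            by (simp add: H[OF f_fin[OF that]] H[OF f_fin[OF x_int]])
        qed
        ultimately have "a (Suc k) - b \<le> inner (gradient ?f ?z - gradient ?\<phi> ?z) (u - ?z)"
          by (rule convex_plus_differentiable_min[OF \<open>ereal_convex_on X F\<close> x_int u F_fin b])
        moreover have "ereal (inner (gradient ?f ?z - gradient ?\<phi> ?z) (u - ?z))
            \<le> ereal (d k - d (Suc k) - H ?z)"
          using three_point[OF u, of k] by (simp add: d H[OF f_fin[OF x_int]])
        moreover have "0 \<le> H ?z"
          using D_nonneg[OF xX, of "Suc k" k] by (simp add: H[OF f_fin[OF x_int]])
        ultimately show ?thesis
          by simp
      qed
      have "a K - b \<le> d 0 / real K"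
        by (rule telescoping_rate[where a = a and d = d, OF step decr d_nonneg K])
      with K show ?thesis
        by (simp add: FK b d)
    qed
  qed
qed

end
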